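(* Let the data $X,K,X_j,\gamma_j,A,Y,\varphi,j,f,R,q,a_S$ satisfy the standing assumptions listed in the context, and let $j_c:X_j\to X_j^*$ be a linear operator such that $\|j_c(z)\|_{X_j^*}\le\alpha_c\|z\|_{X_j}$ and $\langle j_c(z),z\rangle_{X_j}\ge\alpha_j\|z\|_{X_j}^2$ for all $z\in X_j$. Assume $$\alpha_\varphi+\alpha_cc_j^2<m_A,$$ $q\in C^1(\mathbb R_+\times\mathbb R_+;\mathcal L(X))$, and that the solution $u\in C(\mathbb R_+;K)$ of the continuous problem stated in the context satisfies $u\in W^{1,\infty}_{loc}(\mathbb R_+;X)$. Fix $T>0$. For a positive integer $N$ and $k=T/N$ let $u^k=\{u_n^k\}_{n=0}^N\subset K$ satisfy $u_0^k=u(0)$ and, for every $1\le n\le N$ and every $v\in K$, $$\langle Au_n^k,v-u_n^k\rangle+\varphi(\mathcal S_{n,L}^ku^k,u_{n-1}^k,v)-\varphi(\mathcal S_{n,L}^ku^k,u_{n-1}^k,u_n^k)+j^0(\gamma_ju_n^k;\gamma_jv-\gamma_ju_n^k)+\langle j_c(\gamma_ju_n^k),\gamma_jv-\gamma_ju_n^k\rangle_{X_j}$$ $$\ge\langle f_n,v-u_n^k\rangle+\langle j_c(\gamma_ju_{n-1}^k),\gamma_jv-\gamma_ju_n^k\rangle_{X_j}.$$ Then there is a constant $C_3>0$ independent of $k$ such that, with $u_n=u(t_n)$, $$\max_{n\le N}\|u_n-u_n^k\|_X\le C_3k.$$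
   Context: Notation. All spaces are real. $\mathbb R_+=[0,\infty)$; $X^*,X_j^*$ are topological duals; $\langle\cdot,\cdot\rangle$ is the duality pairing between $X^*$ and $X$, $\langle\cdot,\cdot\rangle_{X_j}$ the one between $X_j^*$ and $X_j$; $\mathcal L(\cdot;\cdot)$ denotes bounded linear operators, $\mathcal L(X)=\mathcal L(X;X)$. For a locally Lipschitz $j:X_j\to\mathbb R$, the Clarke directional derivative is $j^0(x;v)=\limsup_{y\to x,\lambda\downarrow0}\frac{j(y+\lambda v)-j(y)}{\lambda}$ and $\partial j(x)=\{\xi\in X_j^*: j^0(x;v)\ge\langle\xi,v\rangle_{X_j}\ \forall v\in X_j\}$. Standing assumptions on the data. $X$ is a reflexive Banach space, $K\subset X$ is closed and convex, $0\in K$. $X_j$ is a Banach space, $\gamma_j\in\mathcal L(X;X_j)$ and $c_j>0$ satisfies $\|\gamma_jv\|_{X_j}\le c_j\|v\|_X$ for all $v\in X$. $A:X\to X^*$ is Lipschitz continuous with constant $L_A>0$ and strongly monotone: $\langle Av_1-Av_2,v_1-v_2\rangle\ge m_A\|v_1-v_2\|_X^2$ for all $v_1,v_2\in X$, with $m_A>0$. $Y$ is a normed space and $\varphi:Y\times K\times K\to\mathbb R$ is such that $\varphi(y,u,\cdot)$ is convex and lower semicontinuous on $K$ for all $y\in Y,u\in K$, and there are $\alpha_\varphi>0,\beta_\varphi>0$ with $\varphi(y_1,u_1,v_2)-\varphi(y_1,u_1,v_1)+\varphi(y_2,u_2,v_1)-\varphi(y_2,u_2,v_2)\le\alpha_\varphi\|u_1-u_2\|_X\|v_1-v_2\|_X+\beta_\varphi\|y_1-y_2\|_Y\|v_1-v_2\|_X$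 for all $y_1,y_2\in Y$, $u_1,u_2,v_1,v_2\in K$. The function $j:X_j\to\mathbb R$ is locally Lipschitz; there are $c_0,c_1\ge0$ with $\|\xi\|_{X_j^*}\le c_0+c_1\|z\|_{X_j}$ for all $z\in X_j$, $\xi\in\partial j(z)$; there is $\alpha_j>0$ with $j^0(z_1;z_2-z_1)+j^0(z_2;z_1-z_2)\le\alpha_j\|z_1-z_2\|_{X_j}^2$ for all $z_1,z_2\in X_j$. $f\in C(\mathbb R_+;X^* )$. $R\in\mathcal L(X;Y)$, $q\in C(\mathbb R_+\times\mathbb R_+;\mathcal L(X))$, $a_S\in X$; these define the history-dependent operator $(\mathcal Sv)(t)=R\left(\int_0^tq(t,s)v(s)\,ds+a_S\right)$ for $v\in C(\mathbb R_+;X)$. Continuous problem. Find $u\in C(\mathbb R_+;K)$ such that for all $t\in\mathbb R_+$ and all $v\in K$, $\langle Au(t),v-u(t)\rangle+\varphi((\mathcal Su)(t),u(t),v)-\varphi((\mathcal Su)(t),u(t),u(t))+j^0(\gamma_ju(t);\gamma_jv-\gamma_ju(t))\ge\langle f(t),v-u(t)\rangle$. Time discretization. $t_n=nk$, $0\le n\le N$, $f_n=f(t_n)$. For a sequence $v=\{v_n\}$ in $X$ and $n\ge1$, $\mathcal S_{n,L}^kv=R\left(\frac k2q(t_n,t_0)v_0+k\sum_{i=1}^{n-1}q(t_n,t_i)v_i+\frac k2q(t_n,t_{n-1})v_{n-1}+a_S\right)$ (empty sum $=0$). *)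

theory Defs
  imports "HOL-Analysis.Analysis"
begin

text \<open>
  The topological dual of \<open>'a\<close> is the normed space \<open>'a \<Rightarrow>\<^sub>L real\<close>, and the duality pairing is
  evaluation of a functional.
\<close>

abbreviation duality_pairing :: "('a::real_normed_vector \<Rightarrow>\<^sub>L real) \<Rightarrow> 'a \<Rightarrow> real"
    ("\<langle>_,/ _\<rangle>")
  where "\<langle>\<xi>, v\<rangle> \<equiv> blinfun_apply \<xi> v"

definition reflexive_space :: "'a::real_normed_vector itself \<Rightarrow> bool" where
  "reflexive_space (_ :: 'a itself) \<longleftrightarrow>
     (\<forall>F :: ('a \<Rightarrow>\<^sub>L real) \<Rightarrow>\<^sub>L real. \<exists>x :: 'a. \<forall>\<xi>. blinfun_apply F \<xi> = \<langle>\<xi>, x\<rangle>)"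


section \<open>Nonsmooth and convex analysis\<close>

definition locally_lipschitz :: "('b::metric_space \<Rightarrow> real) \<Rightarrow> bool" where
  "locally_lipschitz j \<longleftrightarrow> (\<forall>x. \<exists>e>0. \<exists>L. L-lipschitz_on (ball x e) j)"

text \<open>
  The limes superior is taken in the extended reals; it is finite whenever \<open>j\<close> is locally
  Lipschitz, so the conversion back to the reals loses nothing in that case.
\<close>

definition clarke_derivative :: "('b::real_normed_vector \<Rightarrow> real) \<Rightarrow> 'b \<Rightarrow> 'b \<Rightarrow> real" where
  "clarke_derivative j x v =
     real_of_ereal (Limsup (nhds x \<times>\<^sub>F at_right 0)
       (\<lambda>(y, l). ereal ((j (y + l *\<^sub>R v) - j y) / l)))"

definition clarke_subdifferential ::
    "('b::real_normed_vector \<Rightarrow> real) \<Rightarrow> 'b \<Rightarrow> ('b \<Rightarrow>\<^sub>L real) set" where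
  "clarke_subdifferential j x = {\<xi>. \<forall>v. clarke_derivative j x v \<ge> \<langle>\<xi>, v\<rangle>}"

definition lower_semicontinuous_on :: "'a::topological_space set \<Rightarrow> ('a \<Rightarrow> real) \<Rightarrow> bool" where
  "lower_semicontinuous_on K g \<longleftrightarrow>
     (\<forall>x\<in>K. \<forall>c < g x. eventually (\<lambda>y. c < g y) (at x within K))"


section \<open>Vector-valued function spaces\<close>

text \<open>
  \<open>S\<close> may contain boundary points (one-sided derivatives). On a convex set with nonempty interior
  the derivative relative to \<open>S\<close> is unique.
\<close>

definition C1_on :: "'c::real_normed_vector set \<Rightarrow> ('c \<Rightarrow> 'd::real_normed_vector) \<Rightarrow> bool" where
  "C1_on S g \<longleftrightarrow>
     (\<exists>g' :: 'c \<Rightarrow> 'c \<Rightarrow>\<^sub>L 'd. continuous_on S g' \<and>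
        (\<forall>p\<in>S. (g has_derivative blinfun_apply (g' p)) (at p within S)))"

text \<open>
  Strong (Bochner) measurability is spelled out because the library's \<open>borel_measurable\<close> Bochner
  theory requires a second countable target, while the spaces here need not be separable.
\<close>

definition strongly_measurable_on :: "real set \<Rightarrow> (real \<Rightarrow> 'a::real_normed_vector) \<Rightarrow> bool" where
  "strongly_measurable_on I g \<longleftrightarrow>
     (\<exists>s :: nat \<Rightarrow> real \<Rightarrow> 'a.
        (\<forall>n. simple_function (lebesgue_on I) (s n)) \<and>
        (AE t in lebesgue_on I. (\<lambda>n. s n t) \<longlonglongrightarrow> g t))"

definition L_infinity_on :: "real set \<Rightarrow> (real \<Rightarrow> 'a::real_normed_vector) \<Rightarrow> bool" where
  "L_infinity_on I g \<longleftrightarrow>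
     strongly_measurable_on I g \<and> (\<exists>C. AE t in lebesgue_on I. norm (g t) \<le> C)"

definition test_function :: "real set \<Rightarrow> (real \<Rightarrow> real) \<Rightarrow> bool" where
  "test_function I \<psi> \<longleftrightarrow>
     (\<forall>n t. (deriv ^^ n) \<psi> field_differentiable at t) \<and>
     compact (closure {t. \<psi> t \<noteq> 0}) \<and> closure {t. \<psi> t \<noteq> 0} \<subseteq> I"

text \<open>
  The integrals are gauge integrals. For essentially bounded, strongly measurable \<open>u\<close>, \<open>g\<close> and
  bounded \<open>I\<close> (the only case used) both integrands are Bochner integrable, hence gauge integrable
  with the same value.
\<close>

definition weak_derivative_on ::
    "real set \<Rightarrow> (real \<Rightarrow> 'a::real_normed_vector) \<Rightarrow> (real \<Rightarrow> 'a) \<Rightarrow> bool" where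
  "weak_derivative_on I u g \<longleftrightarrow>
     (\<forall>\<psi>. test_function I \<psi> \<longrightarrow>
        (\<exists>J. ((\<lambda>t. deriv \<psi> t *\<^sub>R u t) has_integral J) I \<and>
             ((\<lambda>t. \<psi> t *\<^sub>R g t) has_integral (- J)) I))"

definition W1_infinity_on :: "real set \<Rightarrow> (real \<Rightarrow> 'a::real_normed_vector) \<Rightarrow> bool" where
  "W1_infinity_on I u \<longleftrightarrow>
     L_infinity_on I u \<and> (\<exists>g. L_infinity_on I g \<and> weak_derivative_on I u g)"

definition W1_infinity_loc :: "(real \<Rightarrow> 'a::real_normed_vector) \<Rightarrow> bool" where
  "W1_infinity_loc u \<longleftrightarrow> (\<forall>T>0. W1_infinity_on {0<..<T} u)"


section \<open>The history-dependent operator and its discretization\<close>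

definition history_operator ::
    "('a::banach \<Rightarrow>\<^sub>L 'y::real_normed_vector) \<Rightarrow> (real \<Rightarrow> real \<Rightarrow> 'a \<Rightarrow>\<^sub>L 'a) \<Rightarrow> 'a
      \<Rightarrow> (real \<Rightarrow> 'a) \<Rightarrow> real \<Rightarrow> 'y" where
  "history_operator R q a v t =
     blinfun_apply R (integral {0..t} (\<lambda>s. blinfun_apply (q t s) (v s)) + a)"

text \<open>
  Step size \<open>k\<close>, grid points \<open>t\<^sub>i = i k\<close>; meaningful for \<open>n \<ge> 1\<close>.
\<close>

definition discrete_history_operator ::
    "('a::banach \<Rightarrow>\<^sub>L 'y::real_normed_vector) \<Rightarrow> (real \<Rightarrow> real \<Rightarrow> 'a \<Rightarrow>\<^sub>L 'a) \<Rightarrow> 'a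
      \<Rightarrow> real \<Rightarrow> (nat \<Rightarrow> 'a) \<Rightarrow> nat \<Rightarrow> 'y" where
  "discrete_history_operator R q a k v n =
     (let t = (\<lambda>i::nat. real i * k) in
      blinfun_apply R
        ((k / 2) *\<^sub>R blinfun_apply (q (t n) (t 0)) (v 0)
         + k *\<^sub>R (\<Sum>i = 1..n - 1. blinfun_apply (q (t n) (t i)) (v i))
         + (k / 2) *\<^sub>R blinfun_apply (q (t n) (t (n - 1))) (v (n - 1))
         + a))"

end

theory Submission
  imports Defs
begin

text \<open>
  Write \<open>e\<^sub>n\<close> for the norm of \<open>u(t\<^sub>n) - w\<^sub>n\<close>. Testing the exact inequality at \<open>t\<^sub>n\<close> with \<open>w\<^sub>n\<close> and the
  scheme with \<open>u(t\<^sub>n)\<close> and adding, strong monotonicity of \<open>A\<close> bounds \<open>m\<^sub>A e\<^sub>n\<^sup>2\<close> by the defects of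
  \<open>\<phi>\<close>, of \<open>j\<close> and of \<open>j\<^sub>c\<close>. The difference of the implicit and the explicit \<open>j\<^sub>c\<close> terms has a part
  acting on \<open>\<gamma> (u(t\<^sub>n) - w\<^sub>n)\<close>, whose coercivity compensates the nonconvexity of \<open>j\<close>, and a lagged
  part with constant \<open>\<alpha>\<^sub>c c\<^sub>j\<^sup>2\<close>. This is why the smallness condition is stated with \<open>\<alpha>\<^sub>c\<close>
  (\<open>implicit_step_error\<close>).

  The lagged argument \<open>w\<^sub>n\<^sub>-\<^sub>1\<close> differs from \<open>u(t\<^sub>n)\<close> by at most \<open>e\<^sub>n\<^sub>-\<^sub>1\<close> plus one increment of \<open>u\<close>.
  That increment is \<open>O(k)\<close> because a continuous function with an essentially bounded weak
  derivative is Lipschitz (\<open>lipschitz_on_if_bounded_weak_derivative\<close>). The history term contributes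
  the quadrature error of the Lipschitz integrand \<open>s \<mapsto> q(t\<^sub>n, s) u(s)\<close>, which is \<open>O(k)\<close>
  (\<open>history_operator_consistency\<close>), and \<open>k\<close> times the sum of the earlier errors
  (\<open>discrete_history_operator_stability\<close>). Altogether
  \<open>e\<^sub>n \<le> \<theta> e\<^sub>n\<^sub>-\<^sub>1 + C k + D k (e\<^sub>0 + \<dots> + e\<^sub>n\<^sub>-\<^sub>1)\<close> with
  \<open>\<theta> = (\<alpha>\<^sub>\<phi> + \<alpha>\<^sub>c c\<^sub>j\<^sup>2) / m\<^sub>A < 1\<close>, and \<open>discrete_gronwall\<close> turns this into \<open>e\<^sub>n = O(k)\<close>: since \<open>\<theta> < 1\<close>
  the lagged term does not accumulate over the \<open>T / k\<close> steps.
\<close>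

section \<open>A smooth step function\<close>

text \<open>
  Smoothness is split into finite orders of differentiability because sums, products and
  compositions of \<open>n\<close> times differentiable functions can then be treated by induction on \<open>n\<close>,
  without formulas for higher derivatives.
\<close>

primrec times_differentiable :: "nat \<Rightarrow> (real \<Rightarrow> real) \<Rightarrow> bool" where
  "times_differentiable 0 f \<longleftrightarrow> True"
| "times_differentiable (Suc n) f \<longleftrightarrow>
     (\<exists>f'. (\<forall>x. (f has_real_derivative f' x) (at x)) \<and> times_differentiable n f')"

definition smooth :: "(real \<Rightarrow> real) \<Rightarrow> bool" where
  "smooth f \<longleftrightarrow> (\<forall>n. times_differentiable n f)"

lemma times_differentiable_SucD:
  "times_differentiable (Suc n) f \<Longrightarrow> times_differentiable n f"
proof (induction n arbitrary: f)
  case (Suc n)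
  then obtain f' where f': "\<And>x. (f has_real_derivative f' x) (at x)"
    "times_differentiable (Suc n) f'"
    by (metis times_differentiable.simps(2))
  have "times_differentiable n f'"
    using Suc.IH f'(2) by blast
  then show ?case
    using f'(1) by auto
qed simp

text \<open>
  This matches smoothness to the form in which test functions are required to be infinitely
  differentiable.
\<close>

lemma higher_deriv_differentiable:
  assumes "smooth f"
  shows "(deriv ^^ n) f field_differentiable at x"
proof -
  have "(deriv ^^ n) f field_differentiable at x" if "times_differentiable (Suc n) f"
    using that
  proof (induction n arbitrary: f)
    case 0
    then show ?case by (auto simp: field_differentiable_def)
  next
    case (Suc n)
    then obtain f' where f': "\<And>x. (f has_real_derivative f' x) (at x)"
      "times_differentiable (Suc n) f'"
      by (metis times_differentiable.simps(2))
    have "deriv f = f'"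
      using f'(1) by (auto intro: DERIV_imp_deriv)
    then have "(deriv ^^ Suc n) f = (deriv ^^ n) f'"
      by (simp add: funpow_Suc_right del: funpow.simps)
    then show ?case
      using Suc.IH[OF f'(2)] by simp
  qed
  then show ?thesis
    using assms unfolding smooth_def by blast
qed

lemma times_differentiable_const: "times_differentiable n (\<lambda>x. c)"
proof (induction n arbitrary: c)
  case (Suc n)
  show ?case
    by (auto intro!: exI[of _ "\<lambda>x. 0"] Suc.IH)
qed simp

lemma times_differentiable_ident: "times_differentiable n (\<lambda>x. x)"
proof (cases n)
  case (Suc m)
  then show ?thesis
    by (auto intro!: exI[of _ "\<lambda>x. 1"] times_differentiable_const)
qed simp

lemma times_differentiable_add:
  "times_differentiable n f \<Longrightarrow> times_differentiable n g \<Longrightarrow> times_differentiable n (\<lambda>x. f x + g x)"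
proof (induction n arbitrary: f g)
  case (Suc n)
  then obtain f' g' where "\<And>x. (f has_real_derivative f' x) (at x)" "times_differentiable n f'"
    "\<And>x. (g has_real_derivative g' x) (at x)" "times_differentiable n g'"
    by auto
  then show ?case
    by (auto intro!: exI[of _ "\<lambda>x. f' x + g' x"] DERIV_add Suc.IH)
qed simp

lemma times_differentiable_mult:
  "times_differentiable n f \<Longrightarrow> times_differentiable n g \<Longrightarrow> times_differentiable n (\<lambda>x. f x * g x)"
proof (induction n arbitrary: f g)
  case (Suc n)
  then obtain f' g' where fg: "\<And>x. (f has_real_derivative f' x) (at x)" "times_differentiable n f'"
    "\<And>x. (g has_real_derivative g' x) (at x)" "times_differentiable n g'"
    by auto
  have "times_differentiable n f" "times_differentiable n g"
    using Suc.prems times_differentiable_SucD by blast+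
  then have "times_differentiable n (\<lambda>x. f' x * g x + g' x * f x)"
    by (intro times_differentiable_add Suc.IH fg)
  then show ?case
    using DERIV_mult[OF fg(1) fg(3)]
    by (auto intro!: exI[of _ "\<lambda>x. f' x * g x + g' x * f x"])
qed simp

lemma times_differentiable_compose:
  "times_differentiable n f \<Longrightarrow> times_differentiable n g \<Longrightarrow> times_differentiable n (\<lambda>x. f (g x))"
proof (induction n arbitrary: f g)
  case (Suc n)
  then obtain f' g' where fg: "\<And>x. (f has_real_derivative f' x) (at x)" "times_differentiable n f'"
    "\<And>x. (g has_real_derivative g' x) (at x)" "times_differentiable n g'"
    by auto
  have "times_differentiable n g"
    using Suc.prems times_differentiable_SucD by blast
  then have "times_differentiable n (\<lambda>x. f' (g x) * g' x)"
    by (intro times_differentiable_mult Suc.IH[OF fg(2)] fg(4))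
  then show ?case
    using DERIV_chain2[OF fg(1) fg(3)]
    by (auto intro!: exI[of _ "\<lambda>x. f' (g x) * g' x"])
qed simp

lemma smooth_const: "smooth (\<lambda>x. c)"
  by (simp add: smooth_def times_differentiable_const)

lemma smooth_ident: "smooth (\<lambda>x. x)"
  by (simp add: smooth_def times_differentiable_ident)

lemma smooth_mult: "smooth f \<Longrightarrow> smooth g \<Longrightarrow> smooth (\<lambda>x. f x * g x)"
  unfolding smooth_def by (intro allI times_differentiable_mult) auto

lemma smooth_compose: "smooth f \<Longrightarrow> smooth g \<Longrightarrow> smooth (\<lambda>x. f (g x))"
  unfolding smooth_def by (rule allI, rule times_differentiable_compose) auto

lemma smooth_diff:
  assumes "smooth f" "smooth g"
  shows "smooth (\<lambda>x. f x - g x)"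
proof -
  have "smooth (\<lambda>x. - 1 * g x)"
    by (intro smooth_mult smooth_const assms)
  then have "smooth (\<lambda>x. f x + (- 1 * g x))"
    using assms(1) unfolding smooth_def by (intro allI times_differentiable_add) auto
  then show ?thesis by simp
qed

lemma smooth_has_continuous_derivative:
  assumes "smooth f"
  obtains f' where "\<And>x. (f has_real_derivative f' x) (at x)" "continuous_on UNIV f'"
proof -
  have "times_differentiable (Suc (Suc 0)) f"
    using assms smooth_def by blast
  then obtain f' f'' where f': "\<And>x. (f has_real_derivative f' x) (at x)"
    "\<And>x. (f' has_real_derivative f'' x) (at x)"
    by auto
  then have "continuous_on UNIV f'"
    by (meson DERIV_isCont continuous_at_imp_continuous_on)
  then show thesis using that f'(1) by blast
qed

text \<open>
  The functions \<open>p(1/x) exp(-1/x)\<close>, extended by \<open>0\<close> to \<open>x \<le> 0\<close>. Polynomial factors \<open>p\<close> are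
  included because they make the family closed under differentiation, so that smoothness of every
  member, in particular of \<open>exp(-1/x)\<close>, follows by induction on the order.
\<close>

definition flat_function :: "real poly \<Rightarrow> real \<Rightarrow> real" where
  "flat_function p x = (if x > 0 then poly p (1 / x) * exp (- (1 / x)) else 0)"

lemma poly_times_exp_minus_tendsto_0:
  fixes p :: "real poly"
  shows "((\<lambda>x. poly p x * exp (- x)) \<longlongrightarrow> 0) at_top"
proof -
  have "((\<lambda>x. \<Sum>i\<le>degree p. coeff p i * (x ^ i / exp x)) \<longlongrightarrow> 0) at_top"
    by (intro tendsto_null_sum tendsto_mult_right_zero tendsto_power_div_exp_0)
  then show ?thesis
    by (simp add: poly_altdef exp_minus divide_inverse sum_distrib_right mult.assoc)
qed

lemma flat_function_has_derivative:
  "(flat_function p has_real_derivative flat_function ([:0, 0, 1:] * (p - pderiv p)) x) (at x)"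
proof (cases x "0 :: real" rule: linorder_cases)
  case less
  have "((\<lambda>x. 0) has_real_derivative 0) (at x)" by simp
  then have "(flat_function p has_real_derivative 0) (at x)"
    by (rule has_field_derivative_transform_within_open[where S = "{..<0}"])
       (use less in \<open>auto simp: flat_function_def\<close>)
  then show ?thesis using less by (simp add: flat_function_def)
next
  case greater
  have "((\<lambda>x. poly p (1 / x) * exp (- (1 / x))) has_real_derivative
      flat_function ([:0, 0, 1:] * (p - pderiv p)) x) (at x)"
    using greater
    by (auto intro!: derivative_eq_intros DERIV_chain2[OF poly_DERIV]
        simp: flat_function_def field_simps power2_eq_square)
  then show ?thesis
    by (rule has_field_derivative_transform_within_open[where S = "{0<..}"])
       (use greater in \<open>auto simp: flat_function_def\<close>)
next
  case equal
  \<comment> \<open>The factor \<open>1 / y\<close> of the difference quotient raises the degree of \<open>p\<close> by one.\<close>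
  have "((\<lambda>y. poly (pCons 0 p) (inverse y) * exp (- inverse y)) \<longlongrightarrow> 0) (at_right 0)"
    by (rule filterlim_compose[OF poly_times_exp_minus_tendsto_0 filterlim_inverse_at_top_right])
  then have "((\<lambda>y. (flat_function p y - flat_function p 0) / (y - 0)) \<longlongrightarrow> 0) (at_right 0)"
    by (rule Lim_transform_eventually)
       (auto simp: flat_function_def eventually_at_filter field_simps)
  moreover have "((\<lambda>y. (flat_function p y - flat_function p 0) / (y - 0)) \<longlongrightarrow> 0) (at_left 0)"
    by (rule Lim_transform_eventually[OF tendsto_const])
       (auto simp: flat_function_def eventually_at_filter)
  ultimately show ?thesis
    using equal by (simp add: has_field_derivative_iff filterlim_at_split flat_function_def)
qed

lemma smooth_flat_function: "smooth (flat_function p)"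
proof -
  have "times_differentiable n (flat_function p)" for n
  proof (induction n arbitrary: p)
    case (Suc n)
    then show ?case
      using flat_function_has_derivative by (metis times_differentiable.simps(2))
  qed simp
  then show ?thesis by (simp add: smooth_def)
qed

text \<open>
  With \<open>h(x) = exp(-1/x)\<close> for \<open>x > 0\<close> and \<open>h = 0\<close> elsewhere, a multiple of \<open>h(h(1) - h(1 - x))\<close> is a
  step: the inner function \<open>h(1) - h(1 - x)\<close> is nondecreasing, nonpositive for \<open>x \<le> 0\<close>, where \<open>h\<close>
  vanishes, and constant for \<open>x \<ge> 1\<close>, where \<open>h(1 - x)\<close> vanishes. Thus a composition suffices, and no
  bump function has to be integrated.
\<close>

lemma smooth_step_exists:
  obtains S :: "real \<Rightarrow> real"
  where "smooth S" "mono S" "\<And>x. x \<le> 0 \<Longrightarrow> S x = 0" "\<And>x. 1 \<le> x \<Longrightarrow> S x = 1"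
proof -
  define h where "h = flat_function 1"
  have h: "h x = (if x > 0 then exp (- (1 / x)) else 0)" for x
    by (simp add: h_def flat_function_def)
  have smooth_h: "smooth h"
    by (simp add: h_def smooth_flat_function)
  have mono_h: "h x \<le> h y" if "x \<le> y" for x y
    using that by (auto simp: h frac_le)
  have pos: "h (h 1) > 0" by (simp add: h)
  define S where "S = (\<lambda>x. h (h 1 - h (1 - x)) * inverse (h (h 1)))"
  show thesis
  proof
    show "smooth S"
      unfolding S_def
      by (intro smooth_mult smooth_const smooth_compose[OF smooth_h] smooth_diff smooth_ident)
    show "mono S"
      using pos by (auto simp: S_def intro!: monoI mult_right_mono mono_h)
    show "S x = 0" if "x \<le> 0" for x
    proof -
      have "h 1 - h (1 - x) \<le> 0" using mono_h[of 1 "1 - x"] that by simp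
      then show ?thesis by (simp add: S_def h[of "h 1 - h (1 - x)"])
    qed
    show "S x = 1" if "1 \<le> x" for x
      using that pos by (simp add: S_def h[of "1 - x"])
  qed
qed

section \<open>Bounded weak derivatives and Lipschitz continuity\<close>

text \<open>
  The derivative of a step is a probability density; averaging \<open>u\<close> against it recovers the value \<open>c\<close>
  up to the oscillation \<open>d\<close> of \<open>u\<close> on the support of the density.
\<close>

lemma integral_against_step_derivative:
  fixes u :: "real \<Rightarrow> 'a::banach"
  assumes "l \<le> r" and S: "\<And>t. (S has_real_derivative \<rho> t) (at t)" "S l = 0" "S r = 1"
    and \<rho>: "continuous_on {l..r} \<rho>" "\<And>t. \<rho> t \<ge> 0"
    and u: "continuous_on {l..r} u" "\<And>t. \<rho> t \<noteq> 0 \<Longrightarrow> norm (u t - c) \<le> d"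
  shows "(\<lambda>t. \<rho> t *\<^sub>R u t) integrable_on {l..r}"
    and "norm (integral {l..r} (\<lambda>t. \<rho> t *\<^sub>R u t) - c) \<le> d"
proof -
  show int: "(\<lambda>t. \<rho> t *\<^sub>R u t) integrable_on {l..r}"
    by (intro integrable_continuous_interval continuous_intros \<rho> u)
  have "(\<rho> has_integral (S r - S l)) {l..r}"
    using S(1) \<open>l \<le> r\<close>
    by (intro fundamental_theorem_of_calculus)
       (auto simp: has_real_derivative_iff_has_vector_derivative[symmetric]
             intro: has_field_derivative_at_within)
  then have one: "(\<rho> has_integral 1) {l..r}" by (simp add: S)
  have c: "((\<lambda>t. \<rho> t *\<^sub>R c) has_integral c) {l..r}"
    using has_integral_scaleR_left[OF one, of c] by simp
  have "((\<lambda>t. \<rho> t *\<^sub>R u t - \<rho> t *\<^sub>R c) has_integral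
      (integral {l..r} (\<lambda>t. \<rho> t *\<^sub>R u t) - c)) {l..r}"
    by (intro has_integral_diff c integrable_integral int)
  then have diff: "((\<lambda>t. \<rho> t *\<^sub>R (u t - c)) has_integral
      (integral {l..r} (\<lambda>t. \<rho> t *\<^sub>R u t) - c)) {l..r}"
    by (simp add: scaleR_diff_right)
  have d: "((\<lambda>t. \<rho> t * d) has_integral d) {l..r}"
    using has_integral_mult_left[OF one, of d] by simp
  have "norm (integral {l..r} (\<lambda>t. \<rho> t *\<^sub>R (u t - c))) \<le> integral {l..r} (\<lambda>t. \<rho> t * d)"
  proof (rule Henstock_Kurzweil_Integration.integral_norm_bound_integral)
    show "norm (\<rho> t *\<^sub>R (u t - c)) \<le> \<rho> t * d" for t
      using \<rho>(2)[of t] u(2)[of t] by (cases "\<rho> t = 0") (auto intro: mult_left_mono)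
  qed (use diff d in blast)+
  then show "norm (integral {l..r} (\<lambda>t. \<rho> t *\<^sub>R u t) - c) \<le> d"
    unfolding integral_unique[OF diff] integral_unique[OF d] .
qed

text \<open>
  The set where the bound on \<open>g\<close> fails is negligible, so \<open>g\<close> may be set to \<open>0\<close> there, and the
  integrand is supported in \<open>{a..b}\<close>; the factor \<open>b - a\<close> is the length of that interval.
\<close>

lemma has_integral_norm_bound_AE:
  fixes g :: "real \<Rightarrow> 'a::banach"
  assumes int: "((\<lambda>t. \<psi> t *\<^sub>R g t) has_integral J) {l<..<r}"
    and g: "AE t in lebesgue_on {l<..<r}. norm (g t) \<le> C" "C \<ge> 0"
    and \<psi>: "\<And>t. \<bar>\<psi> t\<bar> \<le> 1" "\<And>t. t \<notin> {a..b} \<Longrightarrow> \<psi> t = 0"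
    and ab: "l < a" "a \<le> b" "b < r"
  shows "norm J \<le> C * (b - a)"
proof -
  define N where "N = {t \<in> {l<..<r}. \<not> norm (g t) \<le> C}"
  define g' where "g' t = (if norm (g t) \<le> C then g t else 0)" for t
  have "AE t in lebesgue. t \<in> {l<..<r} \<longrightarrow> norm (g t) \<le> C"
    using g(1) by (subst (asm) AE_restrict_space_iff) auto
  then have "AE t in lebesgue. t \<notin> N"
    by (auto simp: N_def)
  then have "negligible N"
    unfolding negligible_iff_null_sets eventually_ae_filter
    by (auto intro: null_sets_completion_subset)
  then have "((\<lambda>t. \<psi> t *\<^sub>R g' t) has_integral J) {l<..<r}"
    by (rule has_integral_spike[OF _ _ int]) (auto simp: N_def g'_def)
  then have "((\<lambda>t. if t \<in> {a..b} then \<psi> t *\<^sub>R g' t else 0) has_integral J) {l<..<r}"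
    by (rule has_integral_eq[rotated]) (use \<psi>(2) in auto)
  then have "((\<lambda>t. \<psi> t *\<^sub>R g' t) has_integral J) {a..b}"
    by (subst (asm) has_integral_restrict) (use ab in auto)
  then have "norm J \<le> C * measure lborel (cbox a b)"
  proof (intro has_integral_bound)
    show "norm (\<psi> t *\<^sub>R g' t) \<le> C" for t
      using mult_mono[OF \<psi>(1)[of t], of "norm (g' t)" C] g(2) by (auto simp: g'_def)
  qed (use g(2) in auto)
  then show ?thesis using ab by simp
qed

text \<open>
  For interior points \<open>x < y\<close> take as test function a plateau \<open>\<psi>\<close> that rises from \<open>0\<close> to \<open>1\<close> just after
  \<open>x\<close> and falls back to \<open>0\<close> just after \<open>y\<close>. Its derivative is a difference of two densities
  concentrated near \<open>x\<close> and \<open>y\<close>, so the integral of \<open>\<psi>' u\<close> is close to \<open>u(x) - u(y)\<close>, while the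
  integral of \<open>\<psi> g\<close> is at most \<open>C\<close> times the length of the support of \<open>\<psi>\<close>. Working with the
  vector-valued integrals directly avoids a reduction to scalar functions by functionals.
\<close>

lemma lipschitz_on_if_bounded_weak_derivative:
  fixes u :: "real \<Rightarrow> 'a::banach"
  assumes cont: "continuous_on {l..r} u"
    and weak: "weak_derivative_on {l<..<r} u g"
    and bound: "AE t in lebesgue_on {l<..<r}. norm (g t) \<le> C" "C \<ge> 0"
    and "l < r"
  shows "C-lipschitz_on {l..r} u"
proof -
  obtain S where S: "smooth S" "mono S" "\<And>x. x \<le> 0 \<Longrightarrow> S x = 0" "\<And>x. 1 \<le> x \<Longrightarrow> S x = 1"
    using smooth_step_exists by blast
  obtain S' where S': "\<And>x. (S has_real_derivative S' x) (at x)" "continuous_on UNIV S'"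
    using smooth_has_continuous_derivative[OF S(1)] by blast
  have S'_nonneg: "S' x \<ge> 0" for x
    using S'(1) S(2) by (intro mono_on_imp_deriv_nonneg[where A = UNIV]) auto
  have S'_zero: "S' x = 0" if "x < 0 \<or> x > 1" for x
  proof -
    have "(S has_real_derivative 0) (at x)" if "x < 0"
      by (rule has_field_derivative_transform_within_open[where S = "{..<0}" and f = "\<lambda>_. 0"])
         (use that S in auto)
    moreover have "(S has_real_derivative 0) (at x)" if "x > 1"
      by (rule has_field_derivative_transform_within_open[where S = "{1<..}" and f = "\<lambda>_. 1"])
         (use that S in auto)
    ultimately show ?thesis using that S'(1) DERIV_unique by blast
  qed
  have S_bounds: "0 \<le> S x" "S x \<le> 1" for x
    using S(3)[of "min x 0"] S(4)[of "max x 1"] monoD[OF S(2), of "min x 0" x]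
      monoD[OF S(2), of x "max x 1"] by auto
  have step: "norm (u y - u x) \<le> C * (y - x)" if xy: "l < x" "x < y" "y < r" for x y
  proof (rule field_le_epsilon)
    fix D :: real assume "D > 0"
    \<comment> \<open>Both averages cost \<open>d\<close> each, and the support of the test function exceeds \<open>{x..y}\<close> by at most
        \<open>d\<close>, which costs \<open>C * d\<close>.\<close>
    define d where "d = D / (2 + C)"
    have "d > 0" "D = (2 + C) * d"
      using \<open>D > 0\<close> bound(2) by (auto simp: d_def)
    then have d: "d > 0" "D = 2 * d + C * d"
      by (auto simp: distrib_right)
    have near: "\<exists>e>0. \<forall>t\<in>{l..r}. dist t z < e \<longrightarrow> norm (u t - u z) \<le> d" if "z \<in> {l..r}" for z
      using cont[unfolded continuous_on_iff, rule_format, OF that d(1)]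
      by (auto simp: dist_norm intro: less_imp_le)
    have "x \<in> {l..r}" "y \<in> {l..r}" using xy by auto
    then obtain ex ey
      where ex: "ex > 0" "\<And>t. t \<in> {l..r} \<Longrightarrow> dist t x < ex \<Longrightarrow> norm (u t - u x) \<le> d"
        and ey: "ey > 0" "\<And>t. t \<in> {l..r} \<Longrightarrow> dist t y < ey \<Longrightarrow> norm (u t - u y) \<le> d"
      using near[of x] near[of y] by blast
    \<comment> \<open>The width of the two ramps: \<open>u\<close> varies by at most \<open>d\<close> on either of them, they are disjoint, and
        the second one ends before \<open>r\<close>.\<close>
    define e where "e = Min {d, ex / 2, ey / 2, (r - y) / 2, (y - x) / 2}"
    have "e > 0"
      using d(1) ex(1) ey(1) xy by (simp add: e_def)
    moreover have "e \<le> d" "e \<le> ex / 2" "e \<le> ey / 2" "e \<le> (r - y) / 2" "e \<le> (y - x) / 2"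
      unfolding e_def by (rule Min_le; simp)+
    ultimately have e: "e > 0" "e \<le> d" "e < ex" "e < ey" "y + e < r" "x + e < y"
      by simp_all
    define step where "step = (\<lambda>z t. S ((t - z) / e))"
    define \<rho> where "\<rho> = (\<lambda>z t. S' ((t - z) / e) / e)"
    have deriv_step: "(step z has_real_derivative \<rho> z t) (at t)" for z t
    proof -
      have "((\<lambda>t. (t - z) / e) has_real_derivative 1 / e) (at t)"
        using e(1) by (auto intro!: derivative_eq_intros)
      from DERIV_chain2[OF S'(1) this] show ?thesis
        by (simp add: step_def \<rho>_def)
    qed
    have mollify: "(\<lambda>t. \<rho> z t *\<^sub>R u t) integrable_on {l..r}"
      "norm (integral {l..r} (\<lambda>t. \<rho> z t *\<^sub>R u t) - u z) \<le> d"
      if "z = x \<or> z = y" for z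
    proof -
      have z: "l < z" "z + e < r" using that xy e by auto
      have supp: "norm (u t - u z) \<le> d" if "\<rho> z t \<noteq> 0" for t
      proof -
        have "\<not> (t - z) / e < 0" "\<not> (t - z) / e > 1"
          using that S'_zero unfolding \<rho>_def by fastforce+
        then have "z \<le> t" "t \<le> z + e"
          using e(1) by (auto simp: field_simps)
        then show ?thesis
          using ex(2)[of t] ey(2)[of t] \<open>z = x \<or> z = y\<close> z e by (auto simp: dist_real_def)
      qed
      have ends: "step z l = 0" "step z r = 1"
        using z e(1) by (auto simp: step_def field_simps intro!: S(3,4))
      have cont_\<rho>: "continuous_on {l..r} (\<rho> z)"
        unfolding \<rho>_def using e(1)
        by (auto intro!: continuous_intros continuous_on_compose2[OF S'(2)])
      have nonneg: "\<rho> z t \<ge> 0" for t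
        using S'_nonneg e(1) by (simp add: \<rho>_def)
      show "(\<lambda>t. \<rho> z t *\<^sub>R u t) integrable_on {l..r}"
        "norm (integral {l..r} (\<lambda>t. \<rho> z t *\<^sub>R u t) - u z) \<le> d"
        using integral_against_step_derivative[OF less_imp_le[OF \<open>l < r\<close>] deriv_step ends
            cont_\<rho> nonneg cont supp] by auto
    qed
    define \<psi> where "\<psi> = (\<lambda>t. step x t - step y t)"
    have deriv_\<psi>: "deriv \<psi> t = \<rho> x t - \<rho> y t" for t
      unfolding \<psi>_def using DERIV_diff[OF deriv_step deriv_step] by (rule DERIV_imp_deriv)
    have \<psi>_zero: "\<psi> t = 0" if "t \<notin> {x..y + e}" for t
    proof -
      from that have "t < x \<or> y + e < t" by auto
      then show ?thesis
        using e xy by (elim disjE) (auto simp: \<psi>_def step_def field_simps S)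
    qed
    have \<psi>_le: "\<bar>\<psi> t\<bar> \<le> 1" for t
      using S_bounds[of "(t - x) / e"] S_bounds[of "(t - y) / e"]
      by (auto simp: \<psi>_def step_def)
    have "smooth (step z)" for z
      unfolding step_def
      using smooth_compose[OF S(1) smooth_mult[OF smooth_diff[OF smooth_ident smooth_const]
            smooth_const[of "inverse e"]]] by (simp add: divide_inverse)
    then have "smooth \<psi>"
      unfolding \<psi>_def by (intro smooth_diff)
    moreover have supp: "closure {t. \<psi> t \<noteq> 0} \<subseteq> {x..y + e}"
      using \<psi>_zero by (intro closure_minimal subsetI closed_atLeastAtMost) blast
    moreover have "compact (closure {t. \<psi> t \<noteq> 0})"
      using compact_closure bounded_subset[OF bounded_closed_interval[of x "y + e"]] supp
        closure_subset by (metis (no_types, lifting) order_trans)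
    moreover have "{x..y + e} \<subseteq> {l<..<r}"
      using xy e by auto
    ultimately have "test_function {l<..<r} \<psi>"
      unfolding test_function_def using higher_deriv_differentiable by blast
    then obtain J where J: "((\<lambda>t. deriv \<psi> t *\<^sub>R u t) has_integral J) {l<..<r}"
      "((\<lambda>t. \<psi> t *\<^sub>R g t) has_integral (- J)) {l<..<r}"
      using weak unfolding weak_derivative_on_def by blast
    have "((\<lambda>t. \<rho> x t *\<^sub>R u t - \<rho> y t *\<^sub>R u t) has_integral
        (integral {l..r} (\<lambda>t. \<rho> x t *\<^sub>R u t) - integral {l..r} (\<lambda>t. \<rho> y t *\<^sub>R u t))) {l..r}"
      using mollify(1) by (intro has_integral_diff integrable_integral) auto
    moreover have "((\<lambda>t. \<rho> x t *\<^sub>R u t - \<rho> y t *\<^sub>R u t) has_integral J) {l..r}"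
      using J(1) by (simp add: deriv_\<psi> has_integral_Icc_iff_Ioo scaleR_diff_left)
    ultimately have
      "J = integral {l..r} (\<lambda>t. \<rho> x t *\<^sub>R u t) - integral {l..r} (\<lambda>t. \<rho> y t *\<^sub>R u t)"
      by (rule has_integral_unique[rotated])
    then have "u y - u x = - J + (integral {l..r} (\<lambda>t. \<rho> x t *\<^sub>R u t) - u x)
        - (integral {l..r} (\<lambda>t. \<rho> y t *\<^sub>R u t) - u y)"
      by simp
    also have "norm \<dots> \<le> norm (- J) + d + d"
      by (intro order_trans[OF norm_triangle_ineq4] add_mono order_trans[OF norm_triangle_ineq]
          order_refl mollify(2)) auto
    also have "norm (- J) \<le> C * (y + e - x)"
      using has_integral_norm_bound_AE[OF J(2) bound \<psi>_le \<psi>_zero] xy e by auto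
    also have "\<dots> \<le> C * (y - x) + C * d"
      using mult_left_mono[OF e(2) bound(2)] by (simp add: algebra_simps)
    finally show "norm (u y - u x) \<le> C * (y - x) + D"
      using d(2) by simp
  qed
  have "C-lipschitz_on {l<..<r} u"
  proof (rule lipschitz_onI)
    fix x y assume "x \<in> {l<..<r}" "y \<in> {l<..<r}"
    then show "dist (u x) (u y) \<le> C * dist x y"
      using step[of x y] step[of y x]
      by (cases x y rule: linorder_cases) (auto simp: dist_norm norm_minus_commute)
  qed (use bound in simp)
  then show ?thesis
    using lipschitz_on_closure[of C "{l<..<r}" u] cont \<open>l < r\<close> by simp
qed

section \<open>Quadrature of Lipschitz integrands\<close>

text \<open>
  Two arbitrary nodes are allowed so that the statement covers the trapezoidal rule
  (\<open>p = a\<close>, \<open>p' = b\<close>) and the left rectangle rule (\<open>p = p' = a\<close>) at once.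
\<close>

lemma integral_two_point_error:
  fixes g :: "real \<Rightarrow> 'a::banach"
  assumes g: "M-lipschitz_on {a..b} g" and p: "p \<in> {a..b}" "p' \<in> {a..b}"
  shows "norm (integral {a..b} g - ((b - a) / 2) *\<^sub>R (g p + g p')) \<le> M * (b - a)\<^sup>2"
proof -
  define c where "c = (1 / 2) *\<^sub>R (g p + g p')"
  have "a \<le> b" using p by auto
  have M: "M \<ge> 0" using g lipschitz_on_nonneg by blast
  have "continuous_on {a..b} g"
    using g lipschitz_on_continuous_on by blast
  then have "(g has_integral integral {a..b} g) {a..b}"
    by (intro integrable_integral integrable_continuous_interval)
  then have "((\<lambda>s. g s - c) has_integral (integral {a..b} g - (b - a) *\<^sub>R c)) (cbox a b)"
    using has_integral_diff[OF _ has_integral_const_real[of c a b]] \<open>a \<le> b\<close> by simp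
  moreover have "norm (g s - c) \<le> M * (b - a)" if "s \<in> cbox a b" for s
  proof -
    have near: "norm (g s - g z) \<le> M * (b - a)" if "z \<in> {a..b}" for z
    proof -
      have "dist (g s) (g z) \<le> M * dist s z"
        using lipschitz_onD[OF g] \<open>s \<in> cbox a b\<close> that by auto
      also have "\<dots> \<le> M * (b - a)"
        using M \<open>s \<in> cbox a b\<close> that by (intro mult_left_mono) (auto simp: dist_real_def)
      finally show ?thesis by (simp add: dist_norm)
    qed
    have "g s - c = (1 / 2) *\<^sub>R (g s + g s) - c"
      by (simp only: scaleR_half_double)
    also have "\<dots> = (1 / 2) *\<^sub>R ((g s - g p) + (g s - g p'))"
      by (simp only: c_def scaleR_diff_right[symmetric] add_diff_add)
    also have "norm \<dots> \<le> (1 / 2) * (M * (b - a) + M * (b - a))"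
      using norm_triangle_le[OF add_mono[OF near[OF p(1)] near[OF p(2)]]] by simp
    finally show ?thesis by simp
  qed
  ultimately have "norm (integral {a..b} g - (b - a) *\<^sub>R c) \<le> M * (b - a) * measure lborel (cbox a b)"
    using M \<open>a \<le> b\<close> by (intro has_integral_bound) auto
  then show ?thesis
    using \<open>a \<le> b\<close> by (simp add: c_def power2_eq_square mult.assoc)
qed

text \<open>
  The weights \<open>k/2, k, \<dots>, k\<close> plus a further \<open>k/2\<close> on the last node are those of the trapezoidal rule
  on the first \<open>n - 1\<close> cells together with the left rectangle rule on the last cell. The left
  rectangle keeps the rule explicit in time; it is only first order, so bounding every cell by its
  Lipschitz oscillation loses nothing.
\<close>

lemma left_trapezoid_error:
  fixes g :: "real \<Rightarrow> 'a::banach"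
  assumes g: "M-lipschitz_on {0..real n * k} g" and "k \<ge> 0" and "n \<ge> 1"
  shows "norm (integral {0..real n * k} g
      - ((k / 2) *\<^sub>R g 0 + k *\<^sub>R (\<Sum>i = 1..n - 1. g (real i * k))
          + (k / 2) *\<^sub>R g (real (n - 1) * k)))
    \<le> real n * (M * k\<^sup>2)"
proof -
  define trapez where
    "trapez m = (k / 2) *\<^sub>R g 0 + k *\<^sub>R (\<Sum>i = 1..m. g (real i * k)) - (k / 2) *\<^sub>R g (real m * k)" for m
  have half: "k *\<^sub>R x = (k / 2) *\<^sub>R x + (k / 2) *\<^sub>R x" for x :: 'a
    by (simp flip: scaleR_add_left)
  have cell: "norm (integral {0..real (Suc m) * k} g - integral {0..real m * k} g
      - (k / 2) *\<^sub>R (g p + g p')) \<le> M * k\<^sup>2"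
    if "m < n" "p \<in> {real m * k..real (Suc m) * k}" "p' \<in> {real m * k..real (Suc m) * k}" for m p p'
  proof -
    have le: "0 \<le> real m * k" "real m * k \<le> real (Suc m) * k" "real (Suc m) * k \<le> real n * k"
      using that \<open>k \<ge> 0\<close> by (auto intro!: mult_right_mono)
    have "continuous_on {0..real n * k} g"
      using g lipschitz_on_continuous_on by blast
    then have "g integrable_on {0..real (Suc m) * k}"
      using le by (intro integrable_continuous_interval)
        (rule continuous_on_subset, auto simp del: of_nat_Suc)
    from Henstock_Kurzweil_Integration.integral_combine[OF le(1,2) this]
    have "integral {0..real m * k} g + integral {real m * k..real (Suc m) * k} g
        = integral {0..real (Suc m) * k} g" .
    then have diff: "integral {0..real (Suc m) * k} g - integral {0..real m * k} g
        = integral {real m * k..real (Suc m) * k} g"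
      by (metis add_diff_cancel_left')
    have lip: "M-lipschitz_on {real m * k..real (Suc m) * k} g"
      using le by (intro lipschitz_on_subset[OF g] atLeastatMost_subset_iff[THEN iffD2]) simp
    have width: "real (Suc m) * k - real m * k = k"
      by (simp add: algebra_simps)
    show ?thesis
      unfolding diff using integral_two_point_error[OF lip that(2,3)] unfolding width .
  qed
  have trapez: "norm (integral {0..real m * k} g - trapez m) \<le> real m * (M * k\<^sup>2)" if "m \<le> n" for m
    using that
  proof (induction m)
    case 0
    then show ?case by (simp add: trapez_def)
  next
    case (Suc m)
    have "trapez (Suc m) - trapez m = (k / 2) *\<^sub>R (g (real m * k) + g (real (Suc m) * k))"
      by (simp add: trapez_def half scaleR_add_right del: of_nat_Suc)
    then have "integral {0..real (Suc m) * k} g - trapez (Suc m)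
        = (integral {0..real m * k} g - trapez m)
          + (integral {0..real (Suc m) * k} g - integral {0..real m * k} g
            - (k / 2) *\<^sub>R (g (real m * k) + g (real (Suc m) * k)))"
      by (simp add: algebra_simps del: of_nat_Suc)
    also have "norm \<dots> \<le> real m * (M * k\<^sup>2) + M * k\<^sup>2"
      using Suc \<open>k \<ge> 0\<close>
      by (intro order_trans[OF norm_triangle_ineq] add_mono cell) (auto intro!: mult_right_mono)
    finally show ?case by (simp add: algebra_simps)
  qed
  obtain m where n: "n = Suc m" using \<open>n \<ge> 1\<close> by (cases n) auto
  have "integral {0..real n * k} g
      - ((k / 2) *\<^sub>R g 0 + k *\<^sub>R (\<Sum>i = 1..n - 1. g (real i * k)) + (k / 2) *\<^sub>R g (real (n - 1) * k))
    = (integral {0..real m * k} g - trapez m)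
      + (integral {0..real (Suc m) * k} g - integral {0..real m * k} g
        - (k / 2) *\<^sub>R (g (real m * k) + g (real m * k)))"
    by (simp add: n trapez_def half scaleR_add_right del: of_nat_Suc)
  also have "norm \<dots> \<le> real m * (M * k\<^sup>2) + M * k\<^sup>2"
    using n \<open>k \<ge> 0\<close> trapez
    by (intro order_trans[OF norm_triangle_ineq] add_mono cell) (auto intro!: mult_right_mono)
  finally show ?thesis by (simp add: n algebra_simps)
qed

text \<open>
  On the compact square the derivative is bounded, and the square is convex, so the mean value
  inequality applies.
\<close>

lemma C1_on_lipschitz_second_argument:
  fixes q :: "real \<Rightarrow> real \<Rightarrow> 'a::real_normed_vector"
  assumes "C1_on ({0..} \<times> {0..}) (\<lambda>(t, s). q t s)"
  obtains B where "B \<ge> 0"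
    "\<And>t s s'. \<lbrakk>t \<in> {0..T}; s \<in> {0..T}; s' \<in> {0..T}\<rbrakk> \<Longrightarrow> norm (q t s - q t s') \<le> B * \<bar>s - s'\<bar>"
proof -
  let ?D = "{0..T} \<times> {0..T} :: (real \<times> real) set"
  have sub: "?D \<subseteq> {0..} \<times> {0..}" by auto
  obtain q' where q': "continuous_on ({0..} \<times> {0..}) q'"
    "\<And>p. p \<in> {0..} \<times> {0..} \<Longrightarrow>
      ((\<lambda>(t, s). q t s) has_derivative blinfun_apply (q' p)) (at p within {0..} \<times> {0..})"
    using assms unfolding C1_on_def by auto
  have "compact (q' ` ?D)"
    by (intro compact_continuous_image continuous_on_subset[OF q'(1) sub] compact_Times compact_Icc)
  then obtain B where B: "B > 0" "\<And>p. p \<in> ?D \<Longrightarrow> norm (q' p) \<le> B"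
    using compact_imp_bounded bounded_pos by (metis imageI)
  show thesis
  proof
    show "B \<ge> 0" using B by simp
    fix t s s' assume "t \<in> {0..T}" "s \<in> {0..T}" "s' \<in> {0..T}"
    then have "norm ((\<lambda>(t, s). q t s) (t, s) - (\<lambda>(t, s). q t s) (t, s')) \<le> B * norm ((t, s) - (t, s'))"
      by (intro differentiable_bound[where S = ?D and f' = "\<lambda>p. blinfun_apply (q' p)"])
         (auto intro!: has_derivative_subset[OF q'(2) sub] B(2) convex_Times
           simp flip: norm_blinfun.rep_eq)
    then show "norm (q t s - q t s') \<le> B * \<bar>s - s'\<bar>"
      by (simp add: norm_Pair)
  qed
qed

lemma lipschitz_on_blinfun_apply:
  fixes F :: "'c::metric_space \<Rightarrow> 'a::real_normed_vector \<Rightarrow>\<^sub>L 'b::real_normed_vector"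
  assumes F: "B-lipschitz_on I F" "\<And>s. s \<in> I \<Longrightarrow> norm (F s) \<le> Q"
    and u: "L-lipschitz_on I u" "\<And>s. s \<in> I \<Longrightarrow> norm (u s) \<le> U"
    and "Q \<ge> 0" "U \<ge> 0"
  shows "(B * U + Q * L)-lipschitz_on I (\<lambda>s. blinfun_apply (F s) (u s))"
proof (rule lipschitz_onI)
  show "0 \<le> B * U + Q * L"
    using assms lipschitz_on_nonneg by (metis add_nonneg_nonneg mult_nonneg_nonneg)
  fix s s' assume s: "s \<in> I" "s' \<in> I"
  have "F s (u s) - F s' (u s') = (F s - F s') (u s) + F s' (u s - u s')"
    by (simp add: blinfun.bilinear_simps)
  also have "norm \<dots> \<le> norm (F s - F s') * norm (u s) + norm (F s') * norm (u s - u s')"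
    by (intro order_trans[OF norm_triangle_ineq] add_mono norm_blinfun)
  also have "\<dots> \<le> B * dist s s' * U + Q * (L * dist s s')"
    using lipschitz_onD[OF F(1) s] lipschitz_onD[OF u(1) s] s assms lipschitz_on_nonneg[OF F(1)]
    by (intro add_mono mult_mono) (auto simp: dist_norm)
  finally show "dist (F s (u s)) (F s' (u s')) \<le> (B * U + Q * L) * dist s s'"
    by (simp add: dist_norm algebra_simps)
qed

section \<open>A discrete Gronwall inequality\<close>

text \<open>
  With \<open>E = exp(\<eta> k)\<close> the bound \<open>a n \<le> B k E\<^sup>n\<close> is proved by induction. The geometric sum of the
  earlier bounds is at most \<open>B E\<^sup>n / \<eta>\<close>, since \<open>E - 1 \<ge> \<eta> k\<close>, so the induction step needs
  \<open>\<theta> B + C + B D / \<eta> \<le> B\<close>. The choices \<open>B = 2 C / (1 - \<theta>)\<close> and \<open>\<eta> = 2 D / (1 - \<theta>)\<close> let the last two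
  terms of the left-hand side share \<open>(1 - \<theta>) B\<close> equally.
\<close>

lemma discrete_gronwall:
  fixes a :: "nat \<Rightarrow> real"
  assumes "a 0 = 0" and "0 \<le> \<theta>" "\<theta> < 1" and "C \<ge> 0" "D > 0" "k > 0"
    and rec: "\<And>n. \<lbrakk>1 \<le> n; n \<le> N\<rbrakk> \<Longrightarrow>
      a n \<le> \<theta> * a (n - 1) + C * k + D * k * (\<Sum>i<n. a i)"
    and "n \<le> N"
  shows "a n \<le> 2 * C / (1 - \<theta>) * exp (2 * D / (1 - \<theta>) * (real n * k)) * k"
proof -
  define B \<eta> E where "B = 2 * C / (1 - \<theta>)" and "\<eta> = 2 * D / (1 - \<theta>)" and "E = exp (\<eta> * k)"
  have B: "B \<ge> 0" "C = B * (1 - \<theta>) / 2" and \<eta>: "\<eta> > 0" "D = \<eta> * (1 - \<theta>) / 2"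
    using assms by (auto simp: B_def \<eta>_def)
  have E: "E \<ge> 1 + \<eta> * k" "E > 1"
    using exp_ge_add_one_self[of "\<eta> * k"] mult_pos_pos[OF \<eta>(1) \<open>k > 0\<close>] by (auto simp: E_def)
  have "a n \<le> B * k * E ^ n" using \<open>n \<le> N\<close>
  proof (induction n rule: less_induct)
    case (less n)
    show ?case
    proof (cases "n = 0")
      case True
      then show ?thesis using B \<open>k > 0\<close> \<open>a 0 = 0\<close> by simp
    next
      case False
      have "(\<Sum>i<n. a i) \<le> (\<Sum>i<n. B * k * E ^ i)"
        using less by (intro sum_mono) auto
      also have "\<dots> = B * k * ((E ^ n - 1) / (E - 1))"
        using E by (simp add: geometric_sum flip: sum_distrib_left)
      also have "\<dots> \<le> B * k * (E ^ n / (\<eta> * k))"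
        using E \<eta> \<open>k > 0\<close> B by (intro mult_left_mono frac_le) auto
      finally have sum: "(\<Sum>i<n. a i) \<le> B * E ^ n / \<eta>"
        using \<open>k > 0\<close> by simp
      have "a (n - 1) \<le> B * k * E ^ (n - 1)"
        using less False by auto
      also have "\<dots> \<le> B * k * E ^ n"
        using B \<open>k > 0\<close> E by (intro mult_left_mono power_increasing) auto
      finally have prev: "\<theta> * a (n - 1) \<le> \<theta> * (B * k * E ^ n)"
        using \<open>0 \<le> \<theta>\<close> by (intro mult_left_mono)
      have const: "C * k * 1 \<le> C * k * E ^ n"
        using \<open>C \<ge> 0\<close> \<open>k > 0\<close> E by (intro mult_left_mono) auto
      have "a n \<le> \<theta> * a (n - 1) + C * k + D * k * (\<Sum>i<n. a i)"
        using rec[of n] False less.prems by simp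
      also have "\<dots> \<le> \<theta> * (B * k * E ^ n) + C * k * E ^ n + D * k * (B * E ^ n / \<eta>)"
        using prev const mult_left_mono[OF sum, of "D * k"] \<open>D > 0\<close> \<open>k > 0\<close> by simp
      also have "\<dots> = B * k * E ^ n"
        using \<eta>(1) unfolding B(2) \<eta>(2) by (simp add: field_simps)
      finally show ?thesis .
    qed
  qed
  also have "E ^ n = exp (\<eta> * (real n * k))"
    by (simp add: E_def mult_ac flip: exp_of_nat_mult)
  finally show ?thesis by (simp add: B_def \<eta>_def mult_ac)
qed

section \<open>Error of one time step\<close>

text \<open>
  Here \<open>x\<close> is the exact value, \<open>y\<close> the computed one and \<open>p\<close> the computed value of the previous step.
  Adding the two inequalities cancels \<open>F\<close>. By linearity
  \<open>jc (\<gamma> y) - jc (\<gamma> p) = jc (\<gamma> (x - p)) - jc (\<gamma> (x - y))\<close>: tested with \<open>\<gamma> (x - y)\<close>, the second term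
  is at most \<open>- \<alpha>j (norm (\<gamma> (x - y)))\<^sup>2\<close> and cancels the lack of monotonicity of \<open>J\<close>; the first one is
  controlled by \<open>\<alpha>c c\<^sup>2\<close>. Dividing by \<open>norm (x - y)\<close> gives the linear estimate.
\<close>

lemma implicit_step_error:
  fixes \<gamma> :: "'a::real_normed_vector \<Rightarrow>\<^sub>L 'b::real_normed_vector"
    and A :: "'a \<Rightarrow> 'a \<Rightarrow>\<^sub>L real" and jc :: "'b \<Rightarrow> 'b \<Rightarrow>\<^sub>L real"
    and \<phi> :: "'y::real_normed_vector \<Rightarrow> 'a \<Rightarrow> 'a \<Rightarrow> real" and J :: "'b \<Rightarrow> 'b \<Rightarrow> real"
  assumes exact: "\<langle>A x, y - x\<rangle> + \<phi> \<eta> x y - \<phi> \<eta> x x + J (\<gamma> x) (\<gamma> y - \<gamma> x) \<ge> \<langle>F, y - x\<rangle>"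
    and discrete: "\<langle>A y, x - y\<rangle> + \<phi> \<eta>' p x - \<phi> \<eta>' p y + J (\<gamma> y) (\<gamma> x - \<gamma> y)
        + \<langle>jc (\<gamma> y), \<gamma> x - \<gamma> y\<rangle> \<ge> \<langle>F, x - y\<rangle> + \<langle>jc (\<gamma> p), \<gamma> x - \<gamma> y\<rangle>"
    and A: "\<langle>A x - A y, x - y\<rangle> \<ge> m * (norm (x - y))\<^sup>2"
    and \<phi>: "\<phi> \<eta> x y - \<phi> \<eta> x x + \<phi> \<eta>' p x - \<phi> \<eta>' p y
        \<le> \<alpha> * norm (x - p) * norm (x - y) + \<beta> * norm (\<eta> - \<eta>') * norm (x - y)"
    and J: "J (\<gamma> x) (\<gamma> y - \<gamma> x) + J (\<gamma> y) (\<gamma> x - \<gamma> y) \<le> \<alpha>j * (norm (\<gamma> x - \<gamma> y))\<^sup>2"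
    and jc: "linear jc" "\<alpha>c \<ge> 0" "\<And>z. norm (jc z) \<le> \<alpha>c * norm z" "\<And>z. \<langle>jc z, z\<rangle> \<ge> \<alpha>j * (norm z)\<^sup>2"
    and \<gamma>: "c \<ge> 0" "\<And>v. norm (\<gamma> v) \<le> c * norm v"
    and nonneg: "\<alpha> \<ge> 0" "\<beta> \<ge> 0"
  shows "m * norm (x - y) \<le> (\<alpha> + \<alpha>c * c\<^sup>2) * norm (x - p) + \<beta> * norm (\<eta> - \<eta>')"
proof (cases "x = y")
  case True
  then show ?thesis using nonneg jc(2) by simp
next
  case False
  have "\<langle>jc (\<gamma> (x - p)), \<gamma> (x - y)\<rangle> \<le> norm (jc (\<gamma> (x - p))) * norm (\<gamma> (x - y))"
    by (metis abs_le_D1 norm_blinfun real_norm_def)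
  also have "\<dots> \<le> (\<alpha>c * (c * norm (x - p))) * (c * norm (x - y))"
    using jc(2,3) \<gamma>
    by (intro mult_mono order_trans[OF jc(3)] mult_left_mono \<gamma>) auto
  finally have cross: "\<langle>jc (\<gamma> (x - p)), \<gamma> (x - y)\<rangle> \<le> \<alpha>c * c\<^sup>2 * norm (x - p) * norm (x - y)"
    by (simp add: power2_eq_square mult_ac)
  have "jc (\<gamma> y) - jc (\<gamma> p) = jc (\<gamma> (x - p)) - jc (\<gamma> (x - y))"
    by (simp add: blinfun.diff_right linear_diff[OF jc(1)])
  then have "\<langle>jc (\<gamma> y), \<gamma> (x - y)\<rangle> - \<langle>jc (\<gamma> p), \<gamma> (x - y)\<rangle>
      = \<langle>jc (\<gamma> (x - p)), \<gamma> (x - y)\<rangle> - \<langle>jc (\<gamma> (x - y)), \<gamma> (x - y)\<rangle>"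
    by (metis blinfun.diff_left)
  also have "\<dots> \<le> \<alpha>c * c\<^sup>2 * norm (x - p) * norm (x - y) - \<alpha>j * (norm (\<gamma> (x - y)))\<^sup>2"
    using cross jc(4)[of "\<gamma> (x - y)"] by simp
  finally have split: "\<langle>jc (\<gamma> y), \<gamma> x - \<gamma> y\<rangle> - \<langle>jc (\<gamma> p), \<gamma> x - \<gamma> y\<rangle>
      \<le> \<alpha>c * c\<^sup>2 * norm (x - p) * norm (x - y) - \<alpha>j * (norm (\<gamma> x - \<gamma> y))\<^sup>2"
    by (simp add: blinfun.diff_right)
  have "m * (norm (x - y))\<^sup>2 \<le> \<langle>A x - A y, x - y\<rangle>" by (rule A)
  also have "\<dots> = - \<langle>A x, y - x\<rangle> - \<langle>A y, x - y\<rangle>"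
    by (simp add: blinfun.bilinear_simps)
  also have "\<dots> \<le> \<alpha> * norm (x - p) * norm (x - y) + \<beta> * norm (\<eta> - \<eta>') * norm (x - y)
      + \<alpha>c * c\<^sup>2 * norm (x - p) * norm (x - y)"
    using exact discrete \<phi> J split by (simp add: blinfun.diff_right)
  finally have "(m * norm (x - y)) * norm (x - y)
      \<le> ((\<alpha> + \<alpha>c * c\<^sup>2) * norm (x - p) + \<beta> * norm (\<eta> - \<eta>')) * norm (x - y)"
    by (simp add: algebra_simps power2_eq_square)
  then show ?thesis using False by simp
qed

section \<open>Consistency and stability of the discrete history operator\<close>

lemma history_operator_consistency:
  fixes R :: "'a::banach \<Rightarrow>\<^sub>L 'y::real_normed_vector"
  assumes "M-lipschitz_on {0..real n * k} (\<lambda>s. blinfun_apply (q (real n * k) s) (u s))"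
    and "k \<ge> 0" "n \<ge> 1"
  shows "norm (history_operator R q a u (real n * k)
      - discrete_history_operator R q a k (\<lambda>i. u (real i * k)) n) \<le> norm R * (real n * (M * k\<^sup>2))"
  using order_trans[OF norm_blinfun mult_left_mono[OF left_trapezoid_error[OF assms] norm_ge_zero]]
  by (simp add: history_operator_def discrete_history_operator_def Let_def flip: blinfun.diff_right)

text \<open>
  Each of the three parts of the quadrature rule is bounded by the full sum of the earlier errors,
  and their weights \<open>k/2\<close>, \<open>k\<close> and \<open>k/2\<close> add up to \<open>2 k\<close>.
\<close>

lemma discrete_history_operator_stability:
  fixes R :: "'a::banach \<Rightarrow>\<^sub>L 'y::real_normed_vector"
  assumes q: "\<And>i. i < n \<Longrightarrow> norm (q (real n * k) (real i * k)) \<le> Q" and "k \<ge> 0" "n \<ge> 1"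
  shows "norm (discrete_history_operator R q a k v n - discrete_history_operator R q a k w n)
      \<le> norm R * (2 * Q * k * (\<Sum>i<n. norm (v i - w i)))"
proof -
  define e where "e i = blinfun_apply (q (real n * k) (real i * k)) (v i - w i)" for i
  have e: "norm (e i) \<le> Q * norm (v i - w i)" if "i < n" for i
    unfolding e_def using q[OF that] by (intro order_trans[OF norm_blinfun] mult_right_mono) auto
  let ?s = "\<Sum>i<n. norm (e i)"
  have single: "norm (e i) \<le> ?s" if "i < n" for i
    using that by (intro member_le_sum) auto
  have "(\<Sum>i = 1..n - 1. norm (e i)) \<le> ?s"
    using \<open>n \<ge> 1\<close> by (intro sum_mono2) auto
  then have inner: "norm (\<Sum>i = 1..n - 1. e i) \<le> ?s"
    using norm_sum order_trans by blast
  have "discrete_history_operator R q a k v n - discrete_history_operator R q a k w n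
      = R ((k / 2) *\<^sub>R e 0 + k *\<^sub>R (\<Sum>i = 1..n - 1. e i) + (k / 2) *\<^sub>R e (n - 1))"
    by (simp add: discrete_history_operator_def Let_def e_def blinfun.bilinear_simps sum_subtractf
        algebra_simps)
  also have "norm \<dots> \<le> norm R * (k / 2 * ?s + k * ?s + k / 2 * ?s)"
    using \<open>k \<ge> 0\<close> \<open>n \<ge> 1\<close> inner single
    by (intro order_trans[OF norm_blinfun] mult_left_mono order_trans[OF norm_triangle_ineq] add_mono)
       (auto intro!: mult_left_mono)
  also have "\<dots> = norm R * (2 * k * ?s)" by simp
  also have "\<dots> \<le> norm R * (2 * k * (Q * (\<Sum>i<n. norm (v i - w i))))"
    unfolding sum_distrib_left[of Q] using \<open>k \<ge> 0\<close> e by (intro mult_left_mono sum_mono) auto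
  finally show ?thesis by (simp add: mult_ac)
qed

section \<open>First-order convergence\<close>

theorem theorem11:
  fixes K :: "'a::banach set"
    and \<gamma> :: "'a \<Rightarrow>\<^sub>L 'b::banach"
    and A :: "'a \<Rightarrow> 'a \<Rightarrow>\<^sub>L real"
    and \<phi> :: "'y::real_normed_vector \<Rightarrow> 'a \<Rightarrow> 'a \<Rightarrow> real"
    and j :: "'b \<Rightarrow> real"
    and j\<^sub>c :: "'b \<Rightarrow> 'b \<Rightarrow>\<^sub>L real"
    and f :: "real \<Rightarrow> 'a \<Rightarrow>\<^sub>L real"
    and R :: "'a \<Rightarrow>\<^sub>L 'y"
    and q :: "real \<Rightarrow> real \<Rightarrow> 'a \<Rightarrow>\<^sub>L 'a"
    and a\<^sub>S :: 'a
    and u :: "real \<Rightarrow> 'a"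
    and c\<^sub>j L\<^sub>A m\<^sub>A \<alpha>\<^sub>\<phi> \<beta>\<^sub>\<phi> c\<^sub>0 c\<^sub>1 \<alpha>\<^sub>j \<alpha>\<^sub>c T :: real
  assumes reflexive_X: "reflexive_space TYPE('a)"
    and K: "closed K" "convex K" "0 \<in> K"
    and c\<^sub>j: "c\<^sub>j > 0" "\<And>v. norm (blinfun_apply \<gamma> v) \<le> c\<^sub>j * norm v"
    and A_lipschitz: "L\<^sub>A > 0" "L\<^sub>A-lipschitz_on UNIV A"
    and A_monotone: "m\<^sub>A > 0"
      "\<And>v\<^sub>1 v\<^sub>2. \<langle>A v\<^sub>1 - A v\<^sub>2, v\<^sub>1 - v\<^sub>2\<rangle> \<ge> m\<^sub>A * (norm (v\<^sub>1 - v\<^sub>2))\<^sup>2"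
    and \<phi>_convex_lsc:
      "\<And>y w. w \<in> K \<Longrightarrow> convex_on K (\<phi> y w)"
      "\<And>y w. w \<in> K \<Longrightarrow> lower_semicontinuous_on K (\<phi> y w)"
    and \<phi>_bound: "\<alpha>\<^sub>\<phi> > 0" "\<beta>\<^sub>\<phi> > 0"
      "\<And>y\<^sub>1 y\<^sub>2 u\<^sub>1 u\<^sub>2 v\<^sub>1 v\<^sub>2. \<lbrakk>u\<^sub>1 \<in> K; u\<^sub>2 \<in> K; v\<^sub>1 \<in> K; v\<^sub>2 \<in> K\<rbrakk> \<Longrightarrow>
         \<phi> y\<^sub>1 u\<^sub>1 v\<^sub>2 - \<phi> y\<^sub>1 u\<^sub>1 v\<^sub>1 + \<phi> y\<^sub>2 u\<^sub>2 v\<^sub>1 - \<phi> y\<^sub>2 u\<^sub>2 v\<^sub>2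
           \<le> \<alpha>\<^sub>\<phi> * norm (u\<^sub>1 - u\<^sub>2) * norm (v\<^sub>1 - v\<^sub>2)
             + \<beta>\<^sub>\<phi> * norm (y\<^sub>1 - y\<^sub>2) * norm (v\<^sub>1 - v\<^sub>2)"
    and j_lipschitz: "locally_lipschitz j"
    and j_growth: "c\<^sub>0 \<ge> 0" "c\<^sub>1 \<ge> 0"
      "\<And>z \<xi>. \<xi> \<in> clarke_subdifferential j z \<Longrightarrow> norm \<xi> \<le> c\<^sub>0 + c\<^sub>1 * norm z"
    and j_relaxed_monotone: "\<alpha>\<^sub>j > 0"
      "\<And>z\<^sub>1 z\<^sub>2. clarke_derivative j z\<^sub>1 (z\<^sub>2 - z\<^sub>1) + clarke_derivative j z\<^sub>2 (z\<^sub>1 - z\<^sub>2)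
         \<le> \<alpha>\<^sub>j * (norm (z\<^sub>1 - z\<^sub>2))\<^sup>2"
    and f_continuous: "continuous_on {0..} f"
    and q_continuous: "continuous_on ({0..} \<times> {0..}) (\<lambda>(t, s). q t s)"
    and j\<^sub>c: "linear j\<^sub>c" "\<alpha>\<^sub>c \<ge> 0"
      "\<And>z. norm (j\<^sub>c z) \<le> \<alpha>\<^sub>c * norm z"
      "\<And>z. \<langle>j\<^sub>c z, z\<rangle> \<ge> \<alpha>\<^sub>j * (norm z)\<^sup>2"
    and smallness: "\<alpha>\<^sub>\<phi> + \<alpha>\<^sub>c * c\<^sub>j\<^sup>2 < m\<^sub>A"
    and q_C1: "C1_on ({0..} \<times> {0..}) (\<lambda>(t, s). q t s)"
    and u_space: "continuous_on {0..} u" "\<And>t. t \<ge> 0 \<Longrightarrow> u t \<in> K"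
    and u_solution:
      "\<And>t v. \<lbrakk>t \<ge> 0; v \<in> K\<rbrakk> \<Longrightarrow>
         \<langle>A (u t), v - u t\<rangle>
         + \<phi> (history_operator R q a\<^sub>S u t) (u t) v
         - \<phi> (history_operator R q a\<^sub>S u t) (u t) (u t)
         + clarke_derivative j (blinfun_apply \<gamma> (u t))
             (blinfun_apply \<gamma> v - blinfun_apply \<gamma> (u t))
         \<ge> \<langle>f t, v - u t\<rangle>"
    and u_regular: "W1_infinity_loc u"
    and T: "T > 0"
  shows "\<exists>C\<^sub>3>0. \<forall>(N::nat) (k::real) (w :: nat \<Rightarrow> 'a).
      N > 0 \<longrightarrow> k = T / real N \<longrightarrow>
      (\<forall>n\<le>N. w n \<in> K) \<longrightarrow>
      w 0 = u 0 \<longrightarrow>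
      (\<forall>n\<in>{1..N}. \<forall>v\<in>K.
         \<langle>A (w n), v - w n\<rangle>
         + \<phi> (discrete_history_operator R q a\<^sub>S k w n) (w (n - 1)) v
         - \<phi> (discrete_history_operator R q a\<^sub>S k w n) (w (n - 1)) (w n)
         + clarke_derivative j (blinfun_apply \<gamma> (w n))
             (blinfun_apply \<gamma> v - blinfun_apply \<gamma> (w n))
         + \<langle>j\<^sub>c (blinfun_apply \<gamma> (w n)), blinfun_apply \<gamma> v - blinfun_apply \<gamma> (w n)\<rangle>
         \<ge> \<langle>f (real n * k), v - w n\<rangle>
         + \<langle>j\<^sub>c (blinfun_apply \<gamma> (w (n - 1))),
              blinfun_apply \<gamma> v - blinfun_apply \<gamma> (w n)\<rangle>) \<longrightarrow>
      (MAX n\<in>{..N}. norm (u (real n * k) - w n)) \<le> C\<^sub>3 * k"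
proof -
  obtain g C0 where g: "weak_derivative_on {0<..<T} u g"
    "AE t in lebesgue_on {0<..<T}. norm (g t) \<le> C0"
    using u_regular T unfolding W1_infinity_loc_def W1_infinity_on_def L_infinity_on_def by blast
  define L where "L = max C0 0"
  have "AE t in lebesgue_on {0<..<T}. norm (g t) \<le> L"
    using g(2) by (rule eventually_mono) (simp add: L_def)
  moreover have "continuous_on {0..T} u"
    using u_space(1) by (rule continuous_on_subset) auto
  ultimately have u_lip: "L-lipschitz_on {0..T} u"
    using lipschitz_on_if_bounded_weak_derivative[OF _ g(1)] T by (simp add: L_def)
  have "compact (u ` {0..T})"
    using \<open>continuous_on {0..T} u\<close> by (intro compact_continuous_image) auto
  then obtain U where U: "U > 0" "\<And>s. s \<in> {0..T} \<Longrightarrow> norm (u s) \<le> U"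
    using compact_imp_bounded bounded_pos by (metis imageI)
  have "compact ((\<lambda>(t, s). q t s) ` ({0..T} \<times> {0..T}))"
    by (intro compact_continuous_image continuous_on_subset[OF q_continuous] compact_Times) auto
  then obtain Q where Q: "Q > 0"
    "\<And>p. p \<in> {0..T} \<times> {0..T} \<Longrightarrow> norm ((\<lambda>(t, s). q t s) p) \<le> Q"
    using compact_imp_bounded bounded_pos by (metis imageI)
  have q_bound: "norm (q t s) \<le> Q" if "t \<in> {0..T}" "s \<in> {0..T}" for t s
    using Q(2)[of "(t, s)"] that by simp
  obtain B where B: "B \<ge> 0" "\<And>t s s'. \<lbrakk>t \<in> {0..T}; s \<in> {0..T}; s' \<in> {0..T}\<rbrakk> \<Longrightarrow>
      norm (q t s - q t s') \<le> B * \<bar>s - s'\<bar>"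
    using C1_on_lipschitz_second_argument[OF q_C1] by blast
  define M where "M = B * U + Q * L"
  have integrand_lip: "M-lipschitz_on {0..T} (\<lambda>s. blinfun_apply (q t s) (u s))"
    if "t \<in> {0..T}" for t
    unfolding M_def
  proof (rule lipschitz_on_blinfun_apply)
    show "B-lipschitz_on {0..T} (q t)"
      using B that by (intro lipschitz_onI) (auto simp: dist_norm)
  qed (use that q_bound U Q u_lip in auto)
  have "M \<ge> 0" "L \<ge> 0"
    using B U Q by (auto simp: M_def L_def)
  define \<kappa> where "\<kappa> = \<alpha>\<^sub>\<phi> + \<alpha>\<^sub>c * c\<^sub>j\<^sup>2"
  have \<kappa>: "0 \<le> \<kappa>" "\<kappa> < m\<^sub>A"
    using smallness \<phi>_bound(1) j\<^sub>c(2) by (auto simp: \<kappa>_def)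
  \<comment> \<open>The summand \<open>1\<close> in \<open>D\<close> makes it positive even if \<open>R = 0\<close>, as the growth rate in the Gronwall
      inequality has to be.\<close>
  define \<theta> C D where "\<theta> = \<kappa> / m\<^sub>A"
    and "C = (\<kappa> * L + \<beta>\<^sub>\<phi> * norm R * (T * M)) / m\<^sub>A"
    and "D = 2 * \<beta>\<^sub>\<phi> * norm R * Q / m\<^sub>A + 1"
  have \<theta>: "0 \<le> \<theta>" "\<theta> < 1"
    using \<kappa> A_monotone(1) by (auto simp: \<theta>_def)
  have "C \<ge> 0"
    using \<kappa> \<open>L \<ge> 0\<close> \<open>M \<ge> 0\<close> \<phi>_bound(2) T A_monotone(1) by (simp add: C_def)
  have "D > 0"
    using \<phi>_bound(2) Q(1) A_monotone(1) by (simp add: D_def add_nonneg_pos)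
  \<comment> \<open>The summand \<open>1\<close> keeps the constant positive when \<open>C = 0\<close>.\<close>
  define C3 where "C3 = 2 * C / (1 - \<theta>) * exp (2 * D / (1 - \<theta>) * T) + 1"
  have "C3 > 0"
    using \<theta> \<open>C \<ge> 0\<close> by (simp add: C3_def add_nonneg_pos)
  then show ?thesis
  proof (intro exI[of _ C3] conjI allI impI)
    fix N :: nat and k :: real and w :: "nat \<Rightarrow> 'a"
    assume N: "N > 0" and k: "k = T / real N" and w: "\<forall>n\<le>N. w n \<in> K" "w 0 = u 0"
      and scheme: "\<forall>n\<in>{1..N}. \<forall>v\<in>K.
         \<langle>A (w n), v - w n\<rangle>
         + \<phi> (discrete_history_operator R q a\<^sub>S k w n) (w (n - 1)) v
         - \<phi> (discrete_history_operator R q a\<^sub>S k w n) (w (n - 1)) (w n)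
         + clarke_derivative j (blinfun_apply \<gamma> (w n))
             (blinfun_apply \<gamma> v - blinfun_apply \<gamma> (w n))
         + \<langle>j\<^sub>c (blinfun_apply \<gamma> (w n)), blinfun_apply \<gamma> v - blinfun_apply \<gamma> (w n)\<rangle>
         \<ge> \<langle>f (real n * k), v - w n\<rangle>
         + \<langle>j\<^sub>c (blinfun_apply \<gamma> (w (n - 1))),
              blinfun_apply \<gamma> v - blinfun_apply \<gamma> (w n)\<rangle>"
    have "k > 0" using k N T by simp
    have Nk: "real N * k = T" using k N by simp
    have grid: "real i * k \<in> {0..T}" if "i \<le> N" for i
      using that \<open>k > 0\<close> mult_right_mono[of "real i" "real N" k] by (simp add: Nk)
    define e where "e n = norm (u (real n * k) - w n)" for n
    have recursion: "e n \<le> \<theta> * e (n - 1) + C * k + D * k * (\<Sum>i<n. e i)"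
      if n: "1 \<le> n" "n \<le> N" for n
    proof -
      let ?t = "real n * k"
      let ?\<eta> = "history_operator R q a\<^sub>S u ?t"
      let ?\<eta>' = "discrete_history_operator R q a\<^sub>S k w n"
      have t: "?t \<in> {0..T}" using grid n by blast
      have in_K: "u ?t \<in> K" "w n \<in> K" "w (n - 1) \<in> K"
        using u_space(2) t w(1) n by auto
      have exact: "\<langle>A (u ?t), w n - u ?t\<rangle> + \<phi> ?\<eta> (u ?t) (w n) - \<phi> ?\<eta> (u ?t) (u ?t)
          + clarke_derivative j (\<gamma> (u ?t)) (\<gamma> (w n) - \<gamma> (u ?t)) \<ge> \<langle>f ?t, w n - u ?t\<rangle>"
        using u_solution t in_K by auto
      have discrete: "\<langle>A (w n), u ?t - w n\<rangle> + \<phi> ?\<eta>' (w (n - 1)) (u ?t) - \<phi> ?\<eta>' (w (n - 1)) (w n)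
          + clarke_derivative j (\<gamma> (w n)) (\<gamma> (u ?t) - \<gamma> (w n))
          + \<langle>j\<^sub>c (\<gamma> (w n)), \<gamma> (u ?t) - \<gamma> (w n)\<rangle>
        \<ge> \<langle>f ?t, u ?t - w n\<rangle> + \<langle>j\<^sub>c (\<gamma> (w (n - 1))), \<gamma> (u ?t) - \<gamma> (w n)\<rangle>"
        using scheme n in_K(1) by auto
      have step: "m\<^sub>A * e n \<le> \<kappa> * norm (u ?t - w (n - 1)) + \<beta>\<^sub>\<phi> * norm (?\<eta> - ?\<eta>')"
        unfolding e_def \<kappa>_def
        using implicit_step_error[where J = "clarke_derivative j", OF exact discrete
            A_monotone(2) \<phi>_bound(3)[OF in_K(1,3,1,2)] j_relaxed_monotone(2) j\<^sub>c
            less_imp_le[OF c\<^sub>j(1)] c\<^sub>j(2) less_imp_le[OF \<phi>_bound(1)] less_imp_le[OF \<phi>_bound(2)]] .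
      have "?t - real (n - 1) * k = k"
        using n by (simp add: of_nat_diff algebra_simps)
      then have "norm (u ?t - u (real (n - 1) * k)) \<le> L * k"
        using lipschitz_onD[OF u_lip t grid[of "n - 1"]] n \<open>k > 0\<close> by (simp add: dist_norm)
      then have delay: "norm (u ?t - w (n - 1)) \<le> L * k + e (n - 1)"
        unfolding e_def by (rule norm_diff_triangle_le) simp
      have "norm (?\<eta> - discrete_history_operator R q a\<^sub>S k (\<lambda>i. u (real i * k)) n)
          \<le> norm R * (real n * (M * k\<^sup>2))"
        using t n \<open>k > 0\<close>
        by (intro history_operator_consistency lipschitz_on_subset[OF integrand_lip[OF t]]) auto
      also have "real n * (M * k\<^sup>2) = ?t * (M * k)"
        by (simp add: power2_eq_square)
      also have "norm R * (?t * (M * k)) \<le> norm R * (T * (M * k))"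
        using t \<open>k > 0\<close> \<open>M \<ge> 0\<close> by (intro mult_left_mono mult_right_mono) auto
      finally have consistency: "norm (?\<eta> - discrete_history_operator R q a\<^sub>S k (\<lambda>i. u (real i * k)) n)
          \<le> norm R * (T * (M * k))" .
      have stability: "norm (discrete_history_operator R q a\<^sub>S k (\<lambda>i. u (real i * k)) n - ?\<eta>')
          \<le> norm R * (2 * Q * k * (\<Sum>i<n. e i))"
        unfolding e_def using n \<open>k > 0\<close> t grid
        by (intro discrete_history_operator_stability q_bound) auto
      have history: "norm (?\<eta> - ?\<eta>')
          \<le> norm R * (T * (M * k)) + norm R * (2 * Q * k * (\<Sum>i<n. e i))"
        using consistency stability by (rule norm_diff_triangle_le)
      have "m\<^sub>A * e n \<le> \<kappa> * (L * k + e (n - 1))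
          + \<beta>\<^sub>\<phi> * (norm R * (T * (M * k)) + norm R * (2 * Q * k * (\<Sum>i<n. e i)))"
        using step mult_left_mono[OF delay \<kappa>(1)]
          mult_left_mono[OF history less_imp_le[OF \<phi>_bound(2)]] by linarith
      also have "\<dots> = m\<^sub>A * (\<theta> * e (n - 1) + C * k + (D - 1) * k * (\<Sum>i<n. e i))"
        using A_monotone(1) by (simp add: \<theta>_def C_def D_def field_simps)
      finally have "e n \<le> \<theta> * e (n - 1) + C * k + (D - 1) * k * (\<Sum>i<n. e i)"
        using A_monotone(1) by simp
      also have "(D - 1) * k * (\<Sum>i<n. e i) \<le> D * k * (\<Sum>i<n. e i)"
        using \<open>k > 0\<close> by (intro mult_right_mono) (auto simp: e_def intro!: sum_nonneg)
      finally show ?thesis by simp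
    qed
    have "e n \<le> C3 * k" if "n \<le> N" for n
    proof -
      have "e 0 = 0" by (simp add: e_def w(2))
      then have "e n \<le> 2 * C / (1 - \<theta>) * exp (2 * D / (1 - \<theta>) * (real n * k)) * k"
        using discrete_gronwall[OF _ \<theta> \<open>C \<ge> 0\<close> \<open>D > 0\<close> \<open>k > 0\<close> recursion \<open>n \<le> N\<close>] by blast
      also have "\<dots> \<le> 2 * C / (1 - \<theta>) * exp (2 * D / (1 - \<theta>) * T) * k"
        using \<theta> \<open>C \<ge> 0\<close> \<open>D > 0\<close> \<open>k > 0\<close> grid[OF that]
        by (intro mult_right_mono mult_left_mono iffD2[OF exp_le_cancel_iff]) auto
      also have "\<dots> \<le> C3 * k"
        using \<open>k > 0\<close> by (simp add: C3_def distrib_right)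
      finally show ?thesis .
    qed
    then show "(MAX n\<in>{..N}. norm (u (real n * k) - w n)) \<le> C3 * k"
      by (intro Max.boundedI) (auto simp: e_def)
  qed
qed

end
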